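(* Let $\mathsf{T}=(T,e,m)$ be a monad on $\mathbf{Set}$ factoring coherently through $\mathbf{Sup}$, and let $\mathbf{V}$ be a completely distributive (non-trivial) unital quantale. If $\mathbf{Alg}(\mathsf{T},\mathbf{V})$ denotes the category of $(\mathsf{T},\mathbf{V})$-algebras associated to the Kleisli extension $T_M$ of $T$, then $\mathbf{Alg}(\mathsf{T},\mathbf{V})$ and the category $\mathbf{KlAlg}(\mathsf{T},\mathbf{V})$ of Kleisli $(\mathsf{T},\mathbf{V})$-algebras are concretely isomorphic. More precisely, to a $(\mathsf{T},\mathbf{V})$-algebra structure $r:TX\nrightarrow X$ can be associated a $\mathbf{V}$-tower $\alpha_r=(\alpha_r^a:X\to TX)_{a\in\mathbf{V}}$ defined by $$\alpha_r^a(y):=\bigvee\{\mathfrak{x}\in TX\mid a\le r(\mathfrak{x},y)\},$$ and to a $\mathbf{V}$-tower $\alpha=(\alpha^a:X\to TX)_{a\in\mathbf{V}}$ can be associated a $(\mathsf{T},\mathbf{V})$-algebra structure $r_\alpha:TX\nrightarrow X$ given by $$r_\alpha(\mathfrak{x},y):=\bigvee\{a\in\mathbf{V}\mid \mathfrak{x}\le\alpha^a(y)\}.$$ This correspondence yields two concrete functors $F:\mathbf{Alg}(\mathsf{T},\mathbf{V})\to\mathbf{KlAlg}(\mathsf{T},\mathbf{V})$, $(X,r)\mapsto(X,\alpha_r)$, and $G:\mathbf{KlAlg}(\mathsf{T},\mathbf{V})\to\mathbf{Alg}(\mathsf{T},\mathbf{V})$, $(X,\alpha)\mapsto(X,r_\alpha)$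 (both acting identically on underlying maps), that are inverses of each other.
   Context: **Monads.** $\mathbf{Sup}$ is the category of complete lattices and maps preserving all suprema. A monad $\mathsf{T}=(T,e,m)$ on $\mathbf{Set}$ factors through $\mathbf{Sup}$ if there is a functor $S:\mathbf{Set}\to\mathbf{Sup}$ whose composite with the forgetful functor is $T$, and such that each $m_X:T^2X\to TX$ underlies a $\mathbf{Sup}$-morphism $STX\to SX$; so each $TX$ is a complete lattice and all $Tf$ and $m_X$ preserve suprema. It factors coherently if moreover for all maps $f,g:X\to TY$, $f\le g$ implies $m_Y\cdot Tf\le m_Y\cdot Tg$ (maps into $TY$ are ordered pointwise). The Kleisli composite of $\alpha:X\to TY$ and $\beta:Y\to TZ$ is $\beta\circ\alpha:=m_Z\cdot T\beta\cdot\alpha$. For a map $f:X\to Y$ put $f^\sharp:=e_Y\cdot f:X\to TY$. **Quantales.** A unital quantale $\mathbf{V}$ is a complete lattice with an associative operation $\otimes$ preserving suprema in each variable and a two-sided unit $k$; it is non-trivial if $\bot\neq k$ (always assumed). Write $a\prec b$ if for every $S\subseteq\mathbf{V}$ with $b\le\bigvee S$ there is $s\in S$ with $a\le s$. $\mathbf{V}$ is completely distributive if $b=\bigvee\{a\in\mathbf{V}\mid a\prec b\}$ for all $b\in\mathbf{V}$. **Matrices.** A $\mathbf{V}$-matrix $r:X\nrightarrow Y$ is a map $r:X\times Y\to\mathbf{V}$; matrices are ordered pointwise. The composite of $r:X\nrightarrow Y$ and $s:Y\nrightarrow Z$ is $(s\cdot r)(x,z)=\bigvee_{y\in Y}r(x,y)\otimes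 s(y,z)$; the identity is $1_X(x,y)=k$ if $x=y$ and $\bot$ otherwise. The transpose is $r^\circ(y,x)=r(x,y)$. A map $f:X\to Y$ is identified with the matrix $f(x,y)=k$ if $f(x)=y$, and $\bot$ otherwise. **Kleisli extension.** Let $\eta_X:PX\to TX$ ($PX$ the powerset) be $\eta_X(A)=\bigvee\{e_X(x)\mid x\in A\}$. For a $\mathbf{V}$-matrix $r:X\nrightarrow Y$ and $a\in\mathbf{V}$ let $\rho_r^a:Y\to PX$, $\rho_r^a(y)=\{x\in X\mid a\le r(x,y)\}$. The Kleisli extension $T_M$ of $T$ sends $r:X\nrightarrow Y$ to $T_Mr:TX\nrightarrow TY$, $$T_Mr(\mathfrak{x},\mathfrak{y}):=\bigvee\{a\in\mathbf{V}\mid\mathfrak{x}\le m_X\cdot T(\eta_X\cdot\rho_r^a)(\mathfrak{y})\}.$$ **Lax algebras.** Objects of $\mathbf{Alg}(\mathsf{T},\mathbf{V})$ are pairs $(X,r)$ with $X$ a set and $r:TX\nrightarrow X$ a $\mathbf{V}$-matrix (the algebra structure) with $1_X\le r\cdot e_X$ and $r\cdot T_Mr\le r\cdot m_X$. Morphisms $f:(X,r)\to(Y,s)$ are maps $f:X\to Y$ with $r\le f^\circ\cdot s\cdot Tf$, i.e. $r(\mathfrak{x},y)\le s(Tf(\mathfrak{x}),f(y))$ for all $\mathfrak{x}\in TX$, $y\in X$; composition is as in $\mathbf{Set}$. **Kleisli $(\mathsf{T},\mathbf{V})$-algebras.** Objects of $\mathbf{KlAlg}(\mathsf{T},\mathbf{V})$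 are pairs $(X,\alpha)$ with $X$ a set and $\alpha=(\alpha^a:X\to TX)_{a\in\mathbf{V}}$ a $\mathbf{V}$-tower, i.e. a family of maps with: $\alpha^{\bigvee\mathcal{A}}=\bigwedge_{a\in\mathcal{A}}\alpha^a$ for all $\mathcal{A}\subseteq\mathbf{V}$; $e_X\le\alpha^k$; $\alpha^a\circ\alpha^b\le\alpha^{a\otimes b}$ for all $a,b\in\mathbf{V}$. Morphisms $f:(X,\alpha)\to(Y,\beta)$ are maps $f:X\to Y$ with $f^\sharp\circ\alpha^a\le\beta^a\circ f^\sharp$ (equivalently $Tf\cdot\alpha^a\le\beta^a\cdot f$) for all $a\in\mathbf{V}$; composition is as in $\mathbf{Set}$. A functor between such categories is concrete if it commutes with the forgetful functors to $\mathbf{Set}$; concretely isomorphic means isomorphic via concrete functors. *)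

theory Defs
  imports "HOL-Algebra.Complete_Lattice" "HOL-Library.FuncSet"
begin

section \<open>Categories, functors and monads\<close>

text \<open>
  Morphisms do not carry their domain and codomain; hence \<open>Comp C X Y Z g f\<close> (the composite of
  \<open>f\<close> from \<open>X\<close> to \<open>Y\<close> and \<open>g\<close> from \<open>Y\<close> to \<open>Z\<close>) and the morphism part of a functor take the
  relevant objects as arguments.
\<close>

record ('o, 'm) category =
  Obj :: "'o set"
  Hom :: "'o \<Rightarrow> 'o \<Rightarrow> 'm set"
  Ident :: "'o \<Rightarrow> 'm"
  Comp :: "'o \<Rightarrow> 'o \<Rightarrow> 'o \<Rightarrow> 'm \<Rightarrow> 'm \<Rightarrow> 'm"

definition is_category :: "('o, 'm) category \<Rightarrow> bool" where
  "is_category C \<longleftrightarrow>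
     (\<forall>X\<in>Obj C. Ident C X \<in> Hom C X X) \<and>
     (\<forall>X\<in>Obj C. \<forall>Y\<in>Obj C. \<forall>Z\<in>Obj C. \<forall>f\<in>Hom C X Y. \<forall>g\<in>Hom C Y Z.
        Comp C X Y Z g f \<in> Hom C X Z) \<and>
     (\<forall>X\<in>Obj C. \<forall>Y\<in>Obj C. \<forall>f\<in>Hom C X Y.
        Comp C X X Y f (Ident C X) = f \<and> Comp C X Y Y (Ident C Y) f = f) \<and>
     (\<forall>W\<in>Obj C. \<forall>X\<in>Obj C. \<forall>Y\<in>Obj C. \<forall>Z\<in>Obj C.
        \<forall>f\<in>Hom C W X. \<forall>g\<in>Hom C X Y. \<forall>h\<in>Hom C Y Z.
        Comp C W Y Z h (Comp C W X Y g f) = Comp C W X Z (Comp C X Y Z h g) f)"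

record ('o1, 'm1, 'o2, 'm2) cfunctor =
  omap :: "'o1 \<Rightarrow> 'o2"
  amap :: "'o1 \<Rightarrow> 'o1 \<Rightarrow> 'm1 \<Rightarrow> 'm2"

definition is_functor ::
  "('o1, 'm1) category \<Rightarrow> ('o2, 'm2) category \<Rightarrow> ('o1, 'm1, 'o2, 'm2) cfunctor \<Rightarrow> bool" where
  "is_functor C D F \<longleftrightarrow>
     (\<forall>X\<in>Obj C. omap F X \<in> Obj D) \<and>
     (\<forall>X\<in>Obj C. \<forall>Y\<in>Obj C. \<forall>f\<in>Hom C X Y. amap F X Y f \<in> Hom D (omap F X) (omap F Y)) \<and>
     (\<forall>X\<in>Obj C. amap F X X (Ident C X) = Ident D (omap F X)) \<and>
     (\<forall>X\<in>Obj C. \<forall>Y\<in>Obj C. \<forall>Z\<in>Obj C. \<forall>f\<in>Hom C X Y. \<forall>g\<in>Hom C Y Z.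
        amap F X Z (Comp C X Y Z g f) =
          Comp D (omap F X) (omap F Y) (omap F Z) (amap F Y Z g) (amap F X Y f))"

definition functor_id :: "('o, 'm, 'o, 'm) cfunctor" where
  "functor_id = \<lparr>omap = (\<lambda>X. X), amap = (\<lambda>X Y f. f)\<rparr>"

definition functor_comp ::
  "('o2, 'm2, 'o3, 'm3) cfunctor \<Rightarrow> ('o1, 'm1, 'o2, 'm2) cfunctor \<Rightarrow> ('o1, 'm1, 'o3, 'm3) cfunctor"
where
  "functor_comp G F =
     \<lparr>omap = (\<lambda>X. omap G (omap F X)),
      amap = (\<lambda>X Y f. amap G (omap F X) (omap F Y) (amap F X Y f))\<rparr>"

text \<open>Equality of functors with domain \<open>C\<close>; values outside \<open>C\<close> are disregarded.\<close>

definition functor_eq ::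
  "('o1, 'm1) category \<Rightarrow> ('o1, 'm1, 'o2, 'm2) cfunctor \<Rightarrow> ('o1, 'm1, 'o2, 'm2) cfunctor \<Rightarrow> bool"
where
  "functor_eq C F G \<longleftrightarrow>
     (\<forall>X\<in>Obj C. omap F X = omap G X) \<and>
     (\<forall>X\<in>Obj C. \<forall>Y\<in>Obj C. \<forall>f\<in>Hom C X Y. amap F X Y f = amap G X Y f)"

definition inverse_functors ::
  "('o1, 'm1) category \<Rightarrow> ('o2, 'm2) category \<Rightarrow>
   ('o1, 'm1, 'o2, 'm2) cfunctor \<Rightarrow> ('o2, 'm2, 'o1, 'm1) cfunctor \<Rightarrow> bool" where
  "inverse_functors C D F G \<longleftrightarrow>
     functor_eq C (functor_comp G F) functor_id \<and> functor_eq D (functor_comp F G) functor_id"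

definition nat_trans ::
  "('o1, 'm1) category \<Rightarrow> ('o2, 'm2) category \<Rightarrow>
   ('o1, 'm1, 'o2, 'm2) cfunctor \<Rightarrow> ('o1, 'm1, 'o2, 'm2) cfunctor \<Rightarrow> ('o1 \<Rightarrow> 'm2) \<Rightarrow> bool" where
  "nat_trans C D F G t \<longleftrightarrow>
     (\<forall>X\<in>Obj C. t X \<in> Hom D (omap F X) (omap G X)) \<and>
     (\<forall>X\<in>Obj C. \<forall>Y\<in>Obj C. \<forall>f\<in>Hom C X Y.
        Comp D (omap F X) (omap F Y) (omap G Y) (t Y) (amap F X Y f) =
        Comp D (omap F X) (omap G X) (omap G Y) (amap G X Y f) (t X))"

record ('o, 'm) monad_data =
  mfun :: "('o, 'm, 'o, 'm) cfunctor"
  munit :: "'o \<Rightarrow> 'm"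
  mmult :: "'o \<Rightarrow> 'm"

definition is_monad :: "('o, 'm) category \<Rightarrow> ('o, 'm) monad_data \<Rightarrow> bool" where
  "is_monad C M \<longleftrightarrow>
     (let F = mfun M; T = omap F; e = munit M; m = mmult M in
      is_functor C C F \<and>
      nat_trans C C functor_id F e \<and>
      nat_trans C C (functor_comp F F) F m \<and>
      (\<forall>X\<in>Obj C.
         Comp C (T X) (T (T X)) (T X) (m X) (e (T X)) = Ident C (T X) \<and>
         Comp C (T X) (T (T X)) (T X) (m X) (amap F X (T X) (e X)) = Ident C (T X) \<and>
         Comp C (T (T (T X))) (T (T X)) (T X) (m X) (m (T X)) =
         Comp C (T (T (T X))) (T (T X)) (T X) (m X) (amap F (T (T X)) (T X) (m X))))"

definition concrete_category ::
  "('o2, 'm2) category \<Rightarrow> ('o1, 'm1) category \<Rightarrow> ('o1, 'm1, 'o2, 'm2) cfunctor \<Rightarrow> bool" where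
  "concrete_category B C P \<longleftrightarrow>
     is_category B \<and> is_category C \<and> is_functor C B P \<and>
     (\<forall>X\<in>Obj C. \<forall>Y\<in>Obj C. inj_on (amap P X Y) (Hom C X Y))"

definition concrete_functor ::
  "('o1, 'm1) category \<Rightarrow> ('o1, 'm1, 'b, 'n) cfunctor \<Rightarrow>
   ('o2, 'm2) category \<Rightarrow> ('o2, 'm2, 'b, 'n) cfunctor \<Rightarrow> ('o1, 'm1, 'o2, 'm2) cfunctor \<Rightarrow> bool"
where
  "concrete_functor C P D Q F \<longleftrightarrow> is_functor C D F \<and> functor_eq C (functor_comp Q F) P"

definition concretely_isomorphic ::
  "('o1, 'm1) category \<Rightarrow> ('o1, 'm1, 'b, 'n) cfunctor \<Rightarrow>
   ('o2, 'm2) category \<Rightarrow> ('o2, 'm2, 'b, 'n) cfunctor \<Rightarrow> bool"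
where
  "concretely_isomorphic C P D Q \<longleftrightarrow>
     (\<exists>F G. concrete_functor C P D Q F \<and> concrete_functor D Q C P G \<and> inverse_functors C D F G)"

section \<open>Sets and complete lattices\<close>

text \<open>
  HOL has no category of all sets. \<open>Set_cat U\<close> is the full category of sets on a collection \<open>U\<close> of
  subsets of a type. Nothing is assumed about \<open>U\<close>: the category of sets is the case where \<open>U\<close> is
  the collection of (extensions of) members of a Grothendieck universe. Maps out of \<open>X\<close> are
  extensional functions, so that equality in HOL is equality of maps.
\<close>

definition Set_cat :: "'u set set \<Rightarrow> ('u set, 'u \<Rightarrow> 'u) category" where
  "Set_cat U =
     \<lparr>Obj = U,
      Hom = (\<lambda>X Y. X \<rightarrow>\<^sub>E Y),
      Ident = (\<lambda>X. \<lambda>x\<in>X. x),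
      Comp = (\<lambda>X Y Z g f. compose X g f)\<rparr>"

definition Sup_maps :: "'u gorder \<Rightarrow> 'u gorder \<Rightarrow> ('u \<Rightarrow> 'u) set" where
  "Sup_maps L M =
     {f \<in> carrier L \<rightarrow>\<^sub>E carrier M. \<forall>A\<subseteq>carrier L. f (\<Squnion>\<^bsub>L\<^esub>A) = \<Squnion>\<^bsub>M\<^esub>(f ` A)}"

definition Sup_cat :: "'u set set \<Rightarrow> ('u gorder, 'u \<Rightarrow> 'u) category" where
  "Sup_cat U =
     \<lparr>Obj = {L. Complete_Lattice.complete_lattice L \<and> carrier L \<in> U},
      Hom = Sup_maps,
      Ident = (\<lambda>L. \<lambda>x\<in>carrier L. x),
      Comp = (\<lambda>L M N g f. compose (carrier L) g f)\<rparr>"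

definition Sup_forget :: "('u gorder, 'u \<Rightarrow> 'u, 'u set, 'u \<Rightarrow> 'u) cfunctor" where
  "Sup_forget = \<lparr>omap = carrier, amap = (\<lambda>L M f. f)\<rparr>"

type_synonym 'u set_monad = "('u set, 'u \<Rightarrow> 'u) monad_data"
type_synonym 'u sup_functor = "('u set, 'u \<Rightarrow> 'u, 'u gorder, 'u \<Rightarrow> 'u) cfunctor"

abbreviation Tob :: "'u set_monad \<Rightarrow> 'u set \<Rightarrow> 'u set" where
  "Tob M X \<equiv> omap (mfun M) X"

abbreviation Tmap :: "'u set_monad \<Rightarrow> 'u set \<Rightarrow> 'u set \<Rightarrow> ('u \<Rightarrow> 'u) \<Rightarrow> 'u \<Rightarrow> 'u" where
  "Tmap M X Y f \<equiv> amap (mfun M) X Y f"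

definition factors_through_Sup :: "'u set set \<Rightarrow> 'u set_monad \<Rightarrow> 'u sup_functor \<Rightarrow> bool" where
  "factors_through_Sup U M S \<longleftrightarrow>
     is_functor (Set_cat U) (Sup_cat U) S \<and>
     functor_eq (Set_cat U) (functor_comp Sup_forget S) (mfun M) \<and>
     (\<forall>X\<in>U. mmult M X \<in> Sup_maps (omap S (Tob M X)) (omap S X))"

definition map_le :: "'u sup_functor \<Rightarrow> 'u set \<Rightarrow> 'u set \<Rightarrow> ('u \<Rightarrow> 'u) \<Rightarrow> ('u \<Rightarrow> 'u) \<Rightarrow> bool" where
  "map_le S X Y f g \<longleftrightarrow> (\<forall>x\<in>X. f x \<sqsubseteq>\<^bsub>omap S Y\<^esub> g x)"

definition factors_coherently_through_Sup ::
  "'u set set \<Rightarrow> 'u set_monad \<Rightarrow> 'u sup_functor \<Rightarrow> bool" where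
  "factors_coherently_through_Sup U M S \<longleftrightarrow>
     factors_through_Sup U M S \<and>
     (\<forall>X\<in>U. \<forall>Y\<in>U. \<forall>f\<in>X \<rightarrow>\<^sub>E Tob M Y. \<forall>g\<in>X \<rightarrow>\<^sub>E Tob M Y.
        map_le S X Y f g \<longrightarrow>
        map_le S (Tob M X) Y
          (compose (Tob M X) (mmult M Y) (Tmap M X (Tob M Y) f))
          (compose (Tob M X) (mmult M Y) (Tmap M X (Tob M Y) g)))"

text \<open>\<open>kl_comp M X Y Z b a\<close> is the Kleisli composite of \<open>a\<close> from \<open>X\<close> to \<open>T Y\<close> and \<open>b\<close> from \<open>Y\<close> to \<open>T Z\<close>.\<close>

definition kl_comp ::
  "'u set_monad \<Rightarrow> 'u set \<Rightarrow> 'u set \<Rightarrow> 'u set \<Rightarrow> ('u \<Rightarrow> 'u) \<Rightarrow> ('u \<Rightarrow> 'u) \<Rightarrow> 'u \<Rightarrow> 'u" where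
  "kl_comp M X Y Z b a =
     compose X (compose (Tob M Y) (mmult M Z) (Tmap M Y (Tob M Z) b)) a"

definition sharp :: "'u set_monad \<Rightarrow> 'u set \<Rightarrow> 'u set \<Rightarrow> ('u \<Rightarrow> 'u) \<Rightarrow> 'u \<Rightarrow> 'u" where
  "sharp M X Y f = compose X (munit M Y) f"

section \<open>Quantales and matrices\<close>

text \<open>The tensor is written \<open>*\<close> and its unit \<open>k\<close> is written \<open>1\<close>.\<close>

class unital_quantale = complete_lattice + monoid_mult +
  assumes mult_Sup_right: "a * Sup B = Sup ((\<lambda>b. a * b) ` B)"
    and mult_Sup_left: "Sup B * a = Sup ((\<lambda>b. b * a) ` B)"

definition totally_below :: "'v::complete_lattice \<Rightarrow> 'v \<Rightarrow> bool" where
  "totally_below a b \<longleftrightarrow> (\<forall>A. b \<le> Sup A \<longrightarrow> (\<exists>s\<in>A. a \<le> s))"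

definition completely_distributive :: "'v::complete_lattice itself \<Rightarrow> bool" where
  "completely_distributive _ \<longleftrightarrow> (\<forall>b::'v. b = Sup {a. totally_below a b})"

definition matrices :: "'a set \<Rightarrow> 'b set \<Rightarrow> ('a \<times> 'b \<Rightarrow> 'v) set" where
  "matrices X Y = X \<times> Y \<rightarrow>\<^sub>E UNIV"

definition mat_le :: "'a set \<Rightarrow> 'b set \<Rightarrow> ('a \<times> 'b \<Rightarrow> 'v::order) \<Rightarrow> ('a \<times> 'b \<Rightarrow> 'v) \<Rightarrow> bool" where
  "mat_le X Y r s \<longleftrightarrow> (\<forall>x\<in>X. \<forall>y\<in>Y. r (x, y) \<le> s (x, y))"

definition mat_comp ::
  "'a set \<Rightarrow> 'b set \<Rightarrow> 'c set \<Rightarrow> ('b \<times> 'c \<Rightarrow> 'v) \<Rightarrow> ('a \<times> 'b \<Rightarrow> 'v) \<Rightarrow>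
   'a \<times> 'c \<Rightarrow> 'v::unital_quantale" where
  "mat_comp X Y Z s r = (\<lambda>(x, z)\<in>X \<times> Z. SUP y\<in>Y. r (x, y) * s (y, z))"

definition mat_id :: "'a set \<Rightarrow> 'a \<times> 'a \<Rightarrow> 'v::unital_quantale" where
  "mat_id X = (\<lambda>(x, y)\<in>X \<times> X. if x = y then 1 else bot)"

definition mat_transpose :: "'a set \<Rightarrow> 'b set \<Rightarrow> ('a \<times> 'b \<Rightarrow> 'v) \<Rightarrow> 'b \<times> 'a \<Rightarrow> 'v" where
  "mat_transpose X Y r = (\<lambda>(y, x)\<in>Y \<times> X. r (x, y))"

definition mat_of_map :: "'a set \<Rightarrow> 'b set \<Rightarrow> ('a \<Rightarrow> 'b) \<Rightarrow> 'a \<times> 'b \<Rightarrow> 'v::unital_quantale" where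
  "mat_of_map X Y f = (\<lambda>(x, y)\<in>X \<times> Y. if f x = y then 1 else bot)"

section \<open>The Kleisli extension\<close>

definition eta :: "'u set_monad \<Rightarrow> 'u sup_functor \<Rightarrow> 'u set \<Rightarrow> 'u set \<Rightarrow> 'u" where
  "eta M S X = (\<lambda>A\<in>Pow X. \<Squnion>\<^bsub>omap S X\<^esub>(munit M X ` A))"

definition rho :: "'u set \<Rightarrow> 'u set \<Rightarrow> ('u \<times> 'u \<Rightarrow> 'v::order) \<Rightarrow> 'v \<Rightarrow> 'u \<Rightarrow> 'u set" where
  "rho X Y r a = (\<lambda>y\<in>Y. {x \<in> X. a \<le> r (x, y)})"

definition kleisli_ext ::
  "'u set_monad \<Rightarrow> 'u sup_functor \<Rightarrow> 'u set \<Rightarrow> 'u set \<Rightarrow>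
   ('u \<times> 'u \<Rightarrow> 'v) \<Rightarrow> 'u \<times> 'u \<Rightarrow> 'v::unital_quantale" where
  "kleisli_ext M S X Y r =
     (\<lambda>(x, y)\<in>Tob M X \<times> Tob M Y.
        Sup {a. x \<sqsubseteq>\<^bsub>omap S X\<^esub>
                compose (Tob M Y) (mmult M X)
                  (Tmap M Y (Tob M X) (compose Y (eta M S X) (rho X Y r a))) y})"

section \<open>Lax algebras and Kleisli algebras\<close>

definition is_lax_algebra ::
  "'u set_monad \<Rightarrow> 'u sup_functor \<Rightarrow> 'u set \<Rightarrow> ('u \<times> 'u \<Rightarrow> 'v::unital_quantale) \<Rightarrow> bool" where
  "is_lax_algebra M S X r \<longleftrightarrow>
     (let T = Tob M in
      r \<in> matrices (T X) X \<and>
      mat_le X X (mat_id X) (mat_comp X (T X) X r (mat_of_map X (T X) (munit M X))) \<and>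
      mat_le (T (T X)) X
        (mat_comp (T (T X)) (T X) X r (kleisli_ext M S (T X) X r))
        (mat_comp (T (T X)) (T X) X r (mat_of_map (T (T X)) (T X) (mmult M X))))"

definition lax_hom ::
  "'u set_monad \<Rightarrow> 'u set \<times> ('u \<times> 'u \<Rightarrow> 'v::unital_quantale) \<Rightarrow>
   'u set \<times> ('u \<times> 'u \<Rightarrow> 'v) \<Rightarrow> ('u \<Rightarrow> 'u) set" where
  "lax_hom M = (\<lambda>(X, r) (Y, s). let T = Tob M in
     {f \<in> X \<rightarrow>\<^sub>E Y.
        mat_le (T X) X r
          (mat_comp (T X) Y X (mat_transpose X Y (mat_of_map X Y f))
            (mat_comp (T X) (T Y) Y s (mat_of_map (T X) (T Y) (Tmap M X Y f))))})"

definition Alg ::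
  "'u set set \<Rightarrow> 'u set_monad \<Rightarrow> 'u sup_functor \<Rightarrow>
   ('u set \<times> ('u \<times> 'u \<Rightarrow> 'v::unital_quantale), 'u \<Rightarrow> 'u) category" where
  "Alg U M S =
     \<lparr>Obj = {(X, r). X \<in> U \<and> is_lax_algebra M S X r},
      Hom = lax_hom M,
      Ident = (\<lambda>(X, r). \<lambda>x\<in>X. x),
      Comp = (\<lambda>(X, r) B C g f. compose X g f)\<rparr>"

definition is_tower ::
  "'u set_monad \<Rightarrow> 'u sup_functor \<Rightarrow> 'u set \<Rightarrow> ('v::unital_quantale \<Rightarrow> 'u \<Rightarrow> 'u) \<Rightarrow> bool" where
  "is_tower M S X \<alpha> \<longleftrightarrow>
     (\<forall>a. \<alpha> a \<in> X \<rightarrow>\<^sub>E Tob M X) \<and>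
     (\<forall>A. \<forall>y\<in>X. \<alpha> (Sup A) y = \<Sqinter>\<^bsub>omap S X\<^esub>((\<lambda>a. \<alpha> a y) ` A)) \<and>
     map_le S X X (munit M X) (\<alpha> 1) \<and>
     (\<forall>a b. map_le S X X (kl_comp M X X X (\<alpha> a) (\<alpha> b)) (\<alpha> (a * b)))"

definition kl_hom ::
  "'u set_monad \<Rightarrow> 'u sup_functor \<Rightarrow> 'u set \<times> ('v::unital_quantale \<Rightarrow> 'u \<Rightarrow> 'u) \<Rightarrow>
   'u set \<times> ('v \<Rightarrow> 'u \<Rightarrow> 'u) \<Rightarrow> ('u \<Rightarrow> 'u) set" where
  "kl_hom M S = (\<lambda>(X, \<alpha>) (Y, \<beta>).
     {f \<in> X \<rightarrow>\<^sub>E Y.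
        \<forall>a. map_le S X Y
              (kl_comp M X X Y (sharp M X Y f) (\<alpha> a))
              (kl_comp M X Y Y (\<beta> a) (sharp M X Y f))})"

definition KlAlg ::
  "'u set set \<Rightarrow> 'u set_monad \<Rightarrow> 'u sup_functor \<Rightarrow>
   ('u set \<times> ('v::unital_quantale \<Rightarrow> 'u \<Rightarrow> 'u), 'u \<Rightarrow> 'u) category" where
  "KlAlg U M S =
     \<lparr>Obj = {(X, \<alpha>). X \<in> U \<and> is_tower M S X \<alpha>},
      Hom = kl_hom M S,
      Ident = (\<lambda>(X, \<alpha>). \<lambda>x\<in>X. x),
      Comp = (\<lambda>(X, \<alpha>) B C g f. compose X g f)\<rparr>"

definition forget :: "('u set \<times> 's, 'u \<Rightarrow> 'u, 'u set, 'u \<Rightarrow> 'u) cfunctor" where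
  "forget = \<lparr>omap = fst, amap = (\<lambda>A B f. f)\<rparr>"

definition tower_of ::
  "'u set_monad \<Rightarrow> 'u sup_functor \<Rightarrow> 'u set \<Rightarrow>
   ('u \<times> 'u \<Rightarrow> 'v::unital_quantale) \<Rightarrow> 'v \<Rightarrow> 'u \<Rightarrow> 'u" where
  "tower_of M S X r a = (\<lambda>y\<in>X. \<Squnion>\<^bsub>omap S X\<^esub>{x \<in> Tob M X. a \<le> r (x, y)})"

definition structure_of ::
  "'u set_monad \<Rightarrow> 'u sup_functor \<Rightarrow> 'u set \<Rightarrow>
   ('v::unital_quantale \<Rightarrow> 'u \<Rightarrow> 'u) \<Rightarrow> 'u \<times> 'u \<Rightarrow> 'v" where
  "structure_of M S X \<alpha> = (\<lambda>(x, y)\<in>Tob M X \<times> X. Sup {a. x \<sqsubseteq>\<^bsub>omap S X\<^esub> \<alpha> a y})"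

definition Alg_to_KlAlg ::
  "'u set_monad \<Rightarrow> 'u sup_functor \<Rightarrow>
   ('u set \<times> ('u \<times> 'u \<Rightarrow> 'v::unital_quantale), 'u \<Rightarrow> 'u,
    'u set \<times> ('v \<Rightarrow> 'u \<Rightarrow> 'u), 'u \<Rightarrow> 'u) cfunctor" where
  "Alg_to_KlAlg M S =
     \<lparr>omap = (\<lambda>(X, r). (X, tower_of M S X r)), amap = (\<lambda>A B f. f)\<rparr>"

definition KlAlg_to_Alg ::
  "'u set_monad \<Rightarrow> 'u sup_functor \<Rightarrow>
   ('u set \<times> ('v::unital_quantale \<Rightarrow> 'u \<Rightarrow> 'u), 'u \<Rightarrow> 'u,
    'u set \<times> ('u \<times> 'u \<Rightarrow> 'v), 'u \<Rightarrow> 'u) cfunctor" where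
  "KlAlg_to_Alg M S =
     \<lparr>omap = (\<lambda>(X, \<alpha>). (X, structure_of M S X \<alpha>)), amap = (\<lambda>A B f. f)\<rparr>"

end

theory Submission
  imports Defs
begin

text \<open>
  A structure \<open>r\<close> and a tower \<open>\<alpha>\<close> correspond exactly when \<open>a \<le> r (x, y)\<close> is equivalent to
  \<open>x \<le> \<alpha>\<^sup>a(y)\<close>; such a pair determines each of its members by the formulas for \<open>\<alpha>\<^sub>r\<close> and
  \<open>r\<^sub>\<alpha>\<close>. Every tower has a partner because \<open>a \<mapsto> \<alpha>\<^sup>a(y)\<close> turns suprema into infima. Every
  lax algebra has one because the set of \<open>x\<close> with \<open>a \<le> r (x, y)\<close> is closed under suprema
  and downward closed, both by the multiplication axiom at suitable elements of \<open>TTX\<close>. For a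
  corresponding pair the two sets of axioms, and the two notions of morphism, translate into each
  other through \<open>m\<^sub>X \<cdot> m\<^sub>T\<^sub>X \<cdot> T(\<eta> \<cdot> \<rho>\<^sup>a) = m\<^sub>X \<cdot> T\<alpha>\<^sup>a\<close>.
\<close>

section \<open>Quantale arithmetic and matrices of maps\<close>

text \<open>Preservation of the supremum of \<open>{b, c}\<close>, which is \<open>c\<close>,
  already forces monotonicity.\<close>

lemma quantale_mult_left_mono:
  fixes a b c :: "'v::unital_quantale"
  assumes "b \<le> c"
  shows "a * b \<le> a * c"
proof -
  have "a * Sup {b, c} = Sup {a * b, a * c}"
    using mult_Sup_right[of a "{b, c}"] by simp
  moreover have "Sup {b, c} = c"
    using assms by (simp add: sup_absorb2)
  ultimately show ?thesis
    by (metis Sup_upper insertI1)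
qed

text \<open>Preservation of the empty supremum.\<close>

lemma quantale_mult_bot [simp]:
  fixes a :: "'v::unital_quantale"
  shows "a * bot = bot" and "bot * a = bot"
  using mult_Sup_right[of a "{}"] mult_Sup_left[of "{}" a] by simp_all

lemma SUP_eq_at:
  fixes h :: "'a \<Rightarrow> 'v::complete_lattice"
  assumes "b \<in> A" and "\<And>y. y \<in> A \<Longrightarrow> y \<noteq> b \<Longrightarrow> h y = bot"
  shows "(SUP y\<in>A. h y) = h b"
proof (rule antisym)
  show "(SUP y\<in>A. h y) \<le> h b"
    by (rule SUP_least) (metis assms(2) bot_least order_refl)
qed (use assms(1) in \<open>rule SUP_upper\<close>)

text \<open>In the supremum over \<open>Y\<close> only the term at \<open>f x\<close> can differ
  from \<open>bot\<close>, and there the matrix of \<open>f\<close> contributes the unit. Composing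
  with a map is thus substitution.\<close>

lemma mat_comp_map_right:
  assumes "x \<in> X" "z \<in> Z" "f x \<in> Y"
  shows "mat_comp X Y Z s (mat_of_map X Y f) (x, z) = s (f x, z)"
proof -
  have "mat_comp X Y Z s (mat_of_map X Y f) (x, z) =
      (SUP y\<in>Y. mat_of_map X Y f (x, y) * s (y, z))"
    using assms by (simp add: mat_comp_def)
  also have "\<dots> = mat_of_map X Y f (x, f x) * s (f x, z)"
    by (rule SUP_eq_at) (use assms in \<open>auto simp: mat_of_map_def\<close>)
  finally show ?thesis
    using assms by (simp add: mat_of_map_def)
qed

lemma mat_comp_map_transpose_left:
  assumes "x \<in> X" "z \<in> Z" "f z \<in> Y"
  shows "mat_comp X Y Z (mat_transpose Z Y (mat_of_map Z Y f)) r (x, z) = r (x, f z)"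
proof -
  let ?t = "mat_transpose Z Y (mat_of_map Z Y f)"
  have "mat_comp X Y Z ?t r (x, z) = (SUP y\<in>Y. r (x, y) * ?t (y, z))"
    using assms by (simp add: mat_comp_def)
  also have "\<dots> = r (x, f z) * ?t (f z, z)"
    by (rule SUP_eq_at) (use assms in \<open>auto simp: mat_of_map_def mat_transpose_def\<close>)
  finally show ?thesis
    using assms by (simp add: mat_of_map_def mat_transpose_def)
qed

section \<open>Concrete categories over sets\<close>

lemma is_category_Set_cat: "is_category (Set_cat U)"
  unfolding is_category_def Set_cat_def
  by (auto simp: fun_eq_iff compose_def PiE_iff extensional_def restrict_def)

text \<open>Faithfulness of \<open>forget\<close> is immediate, since it is the identity on
  morphisms.\<close>

lemma concrete_categoryI:
  assumes "is_category C"
    and "\<And>P. P \<in> Obj C \<Longrightarrow> fst P \<in> U"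
    and "\<And>P Q. P \<in> Obj C \<Longrightarrow> Q \<in> Obj C \<Longrightarrow> Hom C P Q \<subseteq> fst P \<rightarrow>\<^sub>E fst Q"
    and "\<And>P. P \<in> Obj C \<Longrightarrow> Ident C P = (\<lambda>x\<in>fst P. x)"
    and "\<And>P Q R g f. P \<in> Obj C \<Longrightarrow> Comp C P Q R g f = compose (fst P) g f"
  shows "concrete_category (Set_cat U) C forget"
  unfolding concrete_category_def is_functor_def
  using assms is_category_Set_cat[of U]
  by (simp add: forget_def Set_cat_def inj_on_def subset_iff)

text \<open>Unit and associativity laws are inherited from composition of extensional functions;
  what is left to check is that the hom-sets contain identities and are closed under
  composition.\<close>

lemma is_category_concreteI:
  fixes C :: "('u set \<times> 's, 'u \<Rightarrow> 'u) category"
  assumes hom: "\<And>P Q. P \<in> Obj C \<Longrightarrow> Q \<in> Obj C \<Longrightarrow> Hom C P Q \<subseteq> fst P \<rightarrow>\<^sub>E fst Q"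
    and ident: "\<And>P. P \<in> Obj C \<Longrightarrow> Ident C P = (\<lambda>x\<in>fst P. x)"
    and comp: "\<And>P Q R g f. P \<in> Obj C \<Longrightarrow> Comp C P Q R g f = compose (fst P) g f"
    and id_in: "\<And>P. P \<in> Obj C \<Longrightarrow> (\<lambda>x\<in>fst P. x) \<in> Hom C P P"
    and comp_in: "\<And>P Q R g f. P \<in> Obj C \<Longrightarrow> Q \<in> Obj C \<Longrightarrow> R \<in> Obj C \<Longrightarrow>
      f \<in> Hom C P Q \<Longrightarrow> g \<in> Hom C Q R \<Longrightarrow> compose (fst P) g f \<in> Hom C P R"
  shows "is_category C"
  unfolding is_category_def
proof (intro conjI ballI)
  fix P Q f assume "P \<in> Obj C" "Q \<in> Obj C" "f \<in> Hom C P Q"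
  moreover from this have "f \<in> fst P \<rightarrow>\<^sub>E fst Q" using hom by blast
  ultimately show "Comp C P P Q f (Ident C P) = f" "Comp C P Q Q (Ident C Q) f = f"
    by (auto simp: ident comp fun_eq_iff compose_def PiE_iff extensional_def)
next
  fix O' P Q R f g h
  assume "O' \<in> Obj C" "P \<in> Obj C" "Q \<in> Obj C" "R \<in> Obj C"
    "f \<in> Hom C O' P" "g \<in> Hom C P Q" "h \<in> Hom C Q R"
  moreover from this have "f \<in> fst O' \<rightarrow> fst P" using hom by (blast dest: PiE_mem)
  ultimately show "Comp C O' Q R h (Comp C O' P Q g f) = Comp C O' P R (Comp C P Q R h g) f"
    by (simp add: comp compose_assoc)
qed (use ident comp id_in comp_in in auto)

section \<open>Monad laws and Kleisli lifts\<close>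

locale coherent_monad =
  fixes U :: "'u set set" and M :: "'u set_monad" and S :: "'u sup_functor"
  assumes monad: "is_monad (Set_cat U) M"
    and coherent: "factors_coherently_through_Sup U M S"
begin

abbreviation "T \<equiv> Tob M"
abbreviation "Tm \<equiv> Tmap M"
abbreviation "e \<equiv> munit M"
abbreviation "m \<equiv> mmult M"
abbreviation le ("(_ \<sqsubseteq>[_] _)" [51, 0, 51] 50) where "x \<sqsubseteq>[X] y \<equiv> x \<sqsubseteq>\<^bsub>omap S X\<^esub> y"
abbreviation Join where "Join X A \<equiv> \<Squnion>\<^bsub>omap S X\<^esub>A"
abbreviation Meet where "Meet X A \<equiv> \<Sqinter>\<^bsub>omap S X\<^esub>A"

text \<open>The Kleisli lift of a map into \<open>T Y\<close> to a map on \<open>T X\<close>, in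
  applied form; Kleisli composites, coherence and the Kleisli extension are all expressed through
  it.\<close>

definition lift :: "'u set \<Rightarrow> 'u set \<Rightarrow> ('u \<Rightarrow> 'u) \<Rightarrow> 'u \<Rightarrow> 'u" where
  "lift X Y f w = m Y (Tm X (T Y) f w)"

lemma functor_T: "is_functor (Set_cat U) (Set_cat U) (mfun M)"
  using monad by (simp add: is_monad_def Let_def)

lemma T_in [simp]: "X \<in> U \<Longrightarrow> T X \<in> U"
  using functor_T by (simp add: is_functor_def Set_cat_def)

lemma Tm_hom: "X \<in> U \<Longrightarrow> Y \<in> U \<Longrightarrow> f \<in> X \<rightarrow>\<^sub>E Y \<Longrightarrow> Tm X Y f \<in> T X \<rightarrow>\<^sub>E T Y"
  using functor_T by (simp add: is_functor_def Set_cat_def)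

lemma Tm_in [simp]: "X \<in> U \<Longrightarrow> Y \<in> U \<Longrightarrow> f \<in> X \<rightarrow>\<^sub>E Y \<Longrightarrow> w \<in> T X \<Longrightarrow> Tm X Y f w \<in> T Y"
  using Tm_hom by (blast dest: PiE_mem)

lemma Tm_id [simp]: "X \<in> U \<Longrightarrow> w \<in> T X \<Longrightarrow> Tm X X (\<lambda>x\<in>X. x) w = w"
  using functor_T by (simp add: is_functor_def Set_cat_def)

lemma Tm_comp:
  assumes "X \<in> U" "Y \<in> U" "Z \<in> U" "f \<in> X \<rightarrow>\<^sub>E Y" "g \<in> Y \<rightarrow>\<^sub>E Z" "w \<in> T X"
  shows "Tm X Z (compose X g f) w = Tm Y Z g (Tm X Y f w)"
proof -
  have "Tm X Z (compose X g f) = compose (T X) (Tm Y Z g) (Tm X Y f)"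
    using functor_T assms by (simp add: is_functor_def Set_cat_def)
  then show ?thesis using assms by (simp add: compose_eq)
qed

lemma e_hom: "X \<in> U \<Longrightarrow> e X \<in> X \<rightarrow>\<^sub>E T X"
  using monad by (simp add: is_monad_def Let_def nat_trans_def Set_cat_def functor_id_def)

lemma m_hom: "X \<in> U \<Longrightarrow> m X \<in> T (T X) \<rightarrow>\<^sub>E T X"
  using monad by (simp add: is_monad_def Let_def nat_trans_def Set_cat_def functor_comp_def)

lemma e_in [simp]: "X \<in> U \<Longrightarrow> x \<in> X \<Longrightarrow> e X x \<in> T X"
  using e_hom by (blast dest: PiE_mem)

lemma m_in [simp]: "X \<in> U \<Longrightarrow> w \<in> T (T X) \<Longrightarrow> m X w \<in> T X"
  using m_hom by (blast dest: PiE_mem)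

lemma e_natural:
  assumes "X \<in> U" "Y \<in> U" "f \<in> X \<rightarrow>\<^sub>E Y" "x \<in> X"
  shows "Tm X Y f (e X x) = e Y (f x)"
proof -
  have "compose X (e Y) f = compose X (Tm X Y f) (e X)"
    using monad assms
    by (simp add: is_monad_def Let_def nat_trans_def Set_cat_def functor_id_def)
  from fun_cong[OF this, of x] show ?thesis using assms by (simp add: compose_eq)
qed

lemma monad_laws:
  assumes "X \<in> U"
  shows "compose (T X) (m X) (e (T X)) = (\<lambda>x\<in>T X. x)"
    and "compose (T X) (m X) (Tm X (T X) (e X)) = (\<lambda>x\<in>T X. x)"
    and "compose (T (T (T X))) (m X) (m (T X)) =
         compose (T (T (T X))) (m X) (Tm (T (T X)) (T X) (m X))"
  using monad assms by (simp_all add: is_monad_def Let_def Set_cat_def)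

lemma m_e [simp]: "X \<in> U \<Longrightarrow> w \<in> T X \<Longrightarrow> m X (e (T X) w) = w"
  using fun_cong[OF monad_laws(1), of X w] by (simp add: compose_eq)

lemma m_Te [simp]: "X \<in> U \<Longrightarrow> w \<in> T X \<Longrightarrow> m X (Tm X (T X) (e X) w) = w"
  using fun_cong[OF monad_laws(2), of X w] by (simp add: compose_eq)

lemma m_assoc: "X \<in> U \<Longrightarrow> w \<in> T (T (T X)) \<Longrightarrow> m X (m (T X) w) = m X (Tm (T (T X)) (T X) (m X) w)"
  using fun_cong[OF monad_laws(3), of X w] by (simp add: compose_eq)

lemma compose_hom: "f \<in> X \<rightarrow>\<^sub>E Y \<Longrightarrow> g \<in> Y \<rightarrow>\<^sub>E Z \<Longrightarrow> compose X g f \<in> X \<rightarrow>\<^sub>E Z"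
  by (auto simp: compose_def)

lemma lift_in [simp]: "X \<in> U \<Longrightarrow> Y \<in> U \<Longrightarrow> f \<in> X \<rightarrow>\<^sub>E T Y \<Longrightarrow> w \<in> T X \<Longrightarrow> lift X Y f w \<in> T Y"
  by (simp add: lift_def)

lemma lift_unit:
  "X \<in> U \<Longrightarrow> Y \<in> U \<Longrightarrow> f \<in> X \<rightarrow>\<^sub>E T Y \<Longrightarrow> x \<in> X \<Longrightarrow> lift X Y f (e X x) = f x"
  using PiE_mem[of f X "\<lambda>_. T Y" x] by (simp add: lift_def e_natural)

lemma lift_sharp:
  assumes "X \<in> U" "Y \<in> U" "f \<in> X \<rightarrow>\<^sub>E Y" "w \<in> T X"
  shows "lift X Y (compose X (e Y) f) w = Tm X Y f w"
  using assms by (simp add: lift_def Tm_comp[of X Y "T Y"] e_hom)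

text \<open>Associativity of the multiplication, combined with functoriality of
  \<open>T\<close>.\<close>

lemma m_lift:
  assumes "X \<in> U" "Y \<in> U" "f \<in> X \<rightarrow>\<^sub>E T (T Y)" "w \<in> T X"
  shows "m Y (lift X (T Y) f w) = lift X Y (compose X (m Y) f) w"
  using assms by (simp add: lift_def m_assoc Tm_comp[of X "T (T Y)" "T Y"] m_hom)

section \<open>The complete lattices on the sets \<open>T X\<close>\<close>

lemma functor_S: "is_functor (Set_cat U) (Sup_cat U) S"
  and m_Sup_map: "X \<in> U \<Longrightarrow> m X \<in> Sup_maps (omap S (T X)) (omap S X)"
  and forget_S: "functor_eq (Set_cat U) (functor_comp Sup_forget S) (mfun M)"
  using coherent by (simp_all add: factors_coherently_through_Sup_def factors_through_Sup_def)

lemma lattice_S: "X \<in> U \<Longrightarrow> Complete_Lattice.complete_lattice (omap S X)"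
  using functor_S by (simp add: is_functor_def Set_cat_def Sup_cat_def)

lemma carrier_S [simp]: "X \<in> U \<Longrightarrow> carrier (omap S X) = T X"
  using forget_S by (simp add: functor_eq_def Set_cat_def functor_comp_def Sup_forget_def)

text \<open>The morphism part of \<open>S\<close> lands in \<open>Sup_cat\<close>, and
  \<open>Sup_forget\<close> leaves maps unchanged, so \<open>forget_S\<close> identifies it with
  \<open>Tm\<close>.\<close>

lemma Tm_Sup_map:
  assumes "X \<in> U" "Y \<in> U" "f \<in> X \<rightarrow>\<^sub>E Y"
  shows "Tm X Y f \<in> Sup_maps (omap S X) (omap S Y)"
proof -
  have "amap S X Y f \<in> Sup_maps (omap S X) (omap S Y)"
    using functor_S assms by (simp add: is_functor_def Set_cat_def Sup_cat_def)
  moreover have "amap S X Y f = Tm X Y f"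
    using forget_S assms by (simp add: functor_eq_def Set_cat_def functor_comp_def Sup_forget_def)
  ultimately show ?thesis by simp
qed

lemma le_refl [simp]: "X \<in> U \<Longrightarrow> x \<in> T X \<Longrightarrow> x \<sqsubseteq>[X] x"
  and le_trans: "X \<in> U \<Longrightarrow> x \<sqsubseteq>[X] y \<Longrightarrow> y \<sqsubseteq>[X] z \<Longrightarrow>
        x \<in> T X \<Longrightarrow> y \<in> T X \<Longrightarrow> z \<in> T X \<Longrightarrow> x \<sqsubseteq>[X] z"
  and le_antisym: "X \<in> U \<Longrightarrow> x \<sqsubseteq>[X] y \<Longrightarrow> y \<sqsubseteq>[X] x \<Longrightarrow> x \<in> T X \<Longrightarrow> y \<in> T X \<Longrightarrow> x = y"
  and Join_in [simp]: "X \<in> U \<Longrightarrow> A \<subseteq> T X \<Longrightarrow> Join X A \<in> T X"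
  and Meet_in [simp]: "X \<in> U \<Longrightarrow> A \<subseteq> T X \<Longrightarrow> Meet X A \<in> T X"
  and Join_upper: "X \<in> U \<Longrightarrow> A \<subseteq> T X \<Longrightarrow> x \<in> A \<Longrightarrow> x \<sqsubseteq>[X] Join X A"
  and Join_least: "X \<in> U \<Longrightarrow> A \<subseteq> T X \<Longrightarrow> z \<in> T X \<Longrightarrow> (\<And>x. x \<in> A \<Longrightarrow> x \<sqsubseteq>[X] z) \<Longrightarrow>
        Join X A \<sqsubseteq>[X] z"
  and Meet_lower: "X \<in> U \<Longrightarrow> A \<subseteq> T X \<Longrightarrow> x \<in> A \<Longrightarrow> Meet X A \<sqsubseteq>[X] x"
  and Meet_greatest: "X \<in> U \<Longrightarrow> A \<subseteq> T X \<Longrightarrow> z \<in> T X \<Longrightarrow> (\<And>x. x \<in> A \<Longrightarrow> z \<sqsubseteq>[X] x) \<Longrightarrow>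
        z \<sqsubseteq>[X] Meet X A"
proof -
  assume X: "X \<in> U"
  interpret L: Complete_Lattice.complete_lattice "omap S X" by (rule lattice_S[OF X])
  note [simp] = carrier_S[OF X]
  show "x \<in> T X \<Longrightarrow> x \<sqsubseteq>[X] x" using L.le_refl by simp
  show "x \<sqsubseteq>[X] y \<Longrightarrow> y \<sqsubseteq>[X] z \<Longrightarrow> x \<in> T X \<Longrightarrow> y \<in> T X \<Longrightarrow> z \<in> T X \<Longrightarrow> x \<sqsubseteq>[X] z"
    using L.le_trans by simp
  show "x \<sqsubseteq>[X] y \<Longrightarrow> y \<sqsubseteq>[X] x \<Longrightarrow> x \<in> T X \<Longrightarrow> y \<in> T X \<Longrightarrow> x = y"
    using L.le_antisym by simp
  show "A \<subseteq> T X \<Longrightarrow> Join X A \<in> T X" using L.sup_closed[of A] by simp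
  show "A \<subseteq> T X \<Longrightarrow> Meet X A \<in> T X" using L.inf_closed[of A] by simp
  show "A \<subseteq> T X \<Longrightarrow> x \<in> A \<Longrightarrow> x \<sqsubseteq>[X] Join X A" using L.sup_upper by simp
  show "A \<subseteq> T X \<Longrightarrow> z \<in> T X \<Longrightarrow> (\<And>x. x \<in> A \<Longrightarrow> x \<sqsubseteq>[X] z) \<Longrightarrow> Join X A \<sqsubseteq>[X] z"
    using L.sup_least by simp
  show "A \<subseteq> T X \<Longrightarrow> x \<in> A \<Longrightarrow> Meet X A \<sqsubseteq>[X] x" using L.inf_lower by simp
  show "A \<subseteq> T X \<Longrightarrow> z \<in> T X \<Longrightarrow> (\<And>x. x \<in> A \<Longrightarrow> z \<sqsubseteq>[X] x) \<Longrightarrow> z \<sqsubseteq>[X] Meet X A"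
    using L.inf_greatest by simp
qed

lemma le_eqI:
  assumes "X \<in> U" "x \<in> T X" "y \<in> T X" "\<And>w. w \<in> T X \<Longrightarrow> w \<sqsubseteq>[X] x \<longleftrightarrow> w \<sqsubseteq>[X] y"
  shows "x = y"
  using assms(4)[of x] assms(4)[of y] assms(1-3) by (auto intro: le_antisym)

lemma Join_principal:
  assumes "X \<in> U" "x \<in> T X"
  shows "Join X {w \<in> T X. w \<sqsubseteq>[X] x} = x"
  by (rule le_antisym) (use assms in \<open>auto intro: Join_upper Join_least\<close>)

lemma Sup_map_Join:
  assumes "X \<in> U" "f \<in> Sup_maps (omap S X) (omap S Y)" "A \<subseteq> T X"
  shows "f (Join X A) = Join Y (f ` A)"
  using assms by (simp add: Sup_maps_def)

text \<open>If \<open>x\<close> lies below \<open>y\<close>, then \<open>y\<close> is the join of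
  both, and \<open>f\<close> preserves this join.\<close>

lemma Sup_map_mono:
  assumes "X \<in> U" "Y \<in> U" and f: "f \<in> Sup_maps (omap S X) (omap S Y)"
    and "x \<in> T X" "y \<in> T X" "x \<sqsubseteq>[X] y"
  shows "f x \<sqsubseteq>[Y] f y"
proof -
  have "Join X {x, y} = y"
    by (rule le_antisym) (use assms in \<open>auto intro: Join_upper Join_least\<close>)
  then have "f y = Join Y {f x, f y}"
    using Sup_map_Join[OF \<open>X \<in> U\<close> f, of "{x, y}"] assms by simp
  moreover have "{f x, f y} \<subseteq> T Y"
    using f assms by (auto simp: Sup_maps_def dest: PiE_mem)
  ultimately show ?thesis
    using Join_upper[OF \<open>Y \<in> U\<close>, of "{f x, f y}" "f x"] by simp
qed

lemmas Tm_mono = Sup_map_mono[OF _ _ Tm_Sup_map]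
lemmas m_mono = Sup_map_mono[OF _ _ m_Sup_map]

lemma lift_mono:
  assumes "X \<in> U" "Y \<in> U" "f \<in> X \<rightarrow>\<^sub>E T Y" "v \<in> T X" "w \<in> T X" "v \<sqsubseteq>[X] w"
  shows "lift X Y f v \<sqsubseteq>[Y] lift X Y f w"
  unfolding lift_def using assms by (auto intro!: m_mono Tm_mono)

text \<open>Monotonicity of the lift in the map is exactly what coherence provides; monotonicity in
  the argument, \<open>lift_mono\<close>, comes from preservation of suprema.\<close>

lemma lift_mono_fun:
  assumes "X \<in> U" "Y \<in> U" "f \<in> X \<rightarrow>\<^sub>E T Y" "g \<in> X \<rightarrow>\<^sub>E T Y"
    and "\<And>x. x \<in> X \<Longrightarrow> f x \<sqsubseteq>[Y] g x" and "w \<in> T X"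
  shows "lift X Y f w \<sqsubseteq>[Y] lift X Y g w"
proof -
  have "map_le S X Y f g" using assms by (simp add: map_le_def)
  then have "map_le S (T X) Y (compose (T X) (m Y) (Tm X (T Y) f)) (compose (T X) (m Y) (Tm X (T Y) g))"
    using coherent assms by (simp add: factors_coherently_through_Sup_def)
  then show ?thesis using assms by (simp add: map_le_def compose_eq lift_def)
qed

lemma kl_comp_apply:
  assumes "x \<in> X" "a x \<in> T Y"
  shows "kl_comp M X Y Z b a x = lift Y Z b (a x)"
  using assms by (simp add: kl_comp_def compose_eq lift_def)

section \<open>The Kleisli extension and the lax algebra axioms\<close>

text \<open>The map whose lift defines the Kleisli extension of \<open>r\<close>; \<open>eta\<close>
  is taken at \<open>T X\<close> because \<open>r\<close> goes from \<open>T X\<close> to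
  \<open>X\<close>.\<close>

definition eta_rho :: "'u set \<Rightarrow> ('u \<times> 'u \<Rightarrow> 'v::unital_quantale) \<Rightarrow> 'v \<Rightarrow> 'u \<Rightarrow> 'u" where
  "eta_rho X r a = compose X (eta M S (T X)) (rho (T X) X r a)"

lemma eta_rho_apply:
  "y \<in> X \<Longrightarrow> eta_rho X r a y = Join (T X) (e (T X) ` {x \<in> T X. a \<le> r (x, y)})"
  by (auto simp: eta_rho_def compose_eq rho_def eta_def)

lemma eta_rho_hom: "X \<in> U \<Longrightarrow> eta_rho X r a \<in> X \<rightarrow>\<^sub>E T (T X)"
  by (rule PiE_I) (auto simp: eta_rho_apply intro!: Join_in, simp add: eta_rho_def compose_def)

text \<open>\<open>m X\<close> preserves joins and cancels \<open>e (T X)\<close>.\<close>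

lemma m_Join_e:
  assumes "X \<in> U" "A \<subseteq> T X"
  shows "m X (Join (T X) (e (T X) ` A)) = Join X A"
proof -
  have "m X ` e (T X) ` A = A" using assms by (force simp: image_image)
  moreover have "e (T X) ` A \<subseteq> T (T X)" using assms by auto
  ultimately show ?thesis
    using assms Sup_map_Join[OF _ m_Sup_map, of X "e (T X) ` A"] by simp
qed

text \<open>By \<open>m_Join_e\<close>, following \<open>eta_rho X r a\<close> by \<open>m X\<close>
  gives the tower of \<open>r\<close>, and \<open>m_lift\<close> moves \<open>m X\<close> inside the
  lift. This links the Kleisli extension to Kleisli composites of towers.\<close>

lemma m_lift_eta_rho:
  assumes "X \<in> U" "y \<in> T X"
  shows "m X (lift X (T X) (eta_rho X r a) y) = lift X X (tower_of M S X r a) y"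
proof -
  have "compose X (m X) (eta_rho X r a) = tower_of M S X r a"
    using assms by (auto simp: fun_eq_iff compose_def tower_of_def eta_rho_apply m_Join_e)
  then show ?thesis using assms by (simp add: m_lift eta_rho_hom)
qed

text \<open>All suprema in the two axioms are removed: composites with maps are substitutions, and
  the tensor distributes over the supremum defining the Kleisli extension, leaving a condition on
  each \<open>a\<close> separately.\<close>

lemma is_lax_algebra_iff:
  fixes r :: "'u \<times> 'u \<Rightarrow> 'v::unital_quantale"
  assumes X: "X \<in> U"
  shows "is_lax_algebra M S X r \<longleftrightarrow> r \<in> matrices (T X) X \<and> (\<forall>x\<in>X. 1 \<le> r (e X x, x)) \<and>
    (\<forall>W\<in>T (T X). \<forall>y\<in>T X. \<forall>z\<in>X. \<forall>a.
       W \<sqsubseteq>[T X] lift X (T X) (eta_rho X r a) y \<longrightarrow> a * r (y, z) \<le> r (m X W, z))"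
proof -
  let ?K = "kleisli_ext M S (T X) X r"
  have "mat_le X X (mat_id X) (mat_comp X (T X) X r (mat_of_map X (T X) (e X))) \<longleftrightarrow>
      (\<forall>x\<in>X. 1 \<le> r (e X x, x))"
    using X by (auto simp: mat_le_def mat_id_def mat_comp_map_right)
  moreover have "mat_le (T (T X)) X (mat_comp (T (T X)) (T X) X r ?K)
        (mat_comp (T (T X)) (T X) X r (mat_of_map (T (T X)) (T X) (m X))) \<longleftrightarrow>
      (\<forall>W\<in>T (T X). \<forall>z\<in>X. \<forall>y\<in>T X. ?K (W, y) * r (y, z) \<le> r (m X W, z))"
    \<comment> \<open>The composite with the matrix of \<open>m X\<close> collapses first; the
      remaining supremum on the left then becomes the quantifier over \<open>y\<close>.\<close>
    using X by (simp add: mat_le_def mat_comp_map_right) (simp add: mat_comp_def SUP_le_iff)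
  moreover have "?K (W, y) * r (y, z) \<le> r (m X W, z) \<longleftrightarrow>
      (\<forall>a. W \<sqsubseteq>[T X] lift X (T X) (eta_rho X r a) y \<longrightarrow> a * r (y, z) \<le> r (m X W, z))"
    if "W \<in> T (T X)" "y \<in> T X" for W y z
    using that
    by (simp add: kleisli_ext_def compose_eq lift_def eta_rho_def mult_Sup_left SUP_le_iff)
  ultimately show ?thesis
    by (auto simp: is_lax_algebra_def Let_def)
qed

section \<open>The Galois connection between structures and towers\<close>

text \<open>For each fixed \<open>y\<close> this is an antitone Galois connection between the
  quantale and \<open>T X\<close>. The extensionality conditions fix the values off the domains, so
  that partners are unique as HOL functions.\<close>

definition adjoint_pair ::
  "'u set \<Rightarrow> ('u \<times> 'u \<Rightarrow> 'v::unital_quantale) \<Rightarrow> ('v \<Rightarrow> 'u \<Rightarrow> 'u) \<Rightarrow> bool" where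
  "adjoint_pair X r \<alpha> \<longleftrightarrow>
     r \<in> matrices (T X) X \<and> (\<forall>a. \<alpha> a \<in> X \<rightarrow>\<^sub>E T X) \<and>
     (\<forall>a. \<forall>x\<in>T X. \<forall>y\<in>X. a \<le> r (x, y) \<longleftrightarrow> x \<sqsubseteq>[X] \<alpha> a y)"

lemma adjoint_pairD:
  assumes "adjoint_pair X r \<alpha>"
  shows "r \<in> matrices (T X) X" and "\<alpha> a \<in> X \<rightarrow>\<^sub>E T X" and "y \<in> X \<Longrightarrow> \<alpha> a y \<in> T X"
    and "x \<in> T X \<Longrightarrow> y \<in> X \<Longrightarrow> a \<le> r (x, y) \<longleftrightarrow> x \<sqsubseteq>[X] \<alpha> a y"
  using assms by (auto simp: adjoint_pair_def)

text \<open>By adjointness, the set whose join defines the tower is the principal down-set of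
  \<open>\<alpha> a y\<close>.\<close>

lemma adjoint_pair_tower_of:
  assumes "X \<in> U" "adjoint_pair X r \<alpha>"
  shows "tower_of M S X r = \<alpha>"
proof (intro ext)
  fix a y
  show "tower_of M S X r a y = \<alpha> a y"
  proof (cases "y \<in> X")
    case True
    then have "tower_of M S X r a y = Join X {x \<in> T X. x \<sqsubseteq>[X] \<alpha> a y}"
      using adjoint_pairD(4)[OF assms(2)] by (simp add: tower_of_def cong: conj_cong)
    then show ?thesis
      using Join_principal assms(1) adjoint_pairD(3)[OF assms(2) True] by simp
  next
    case False
    then show ?thesis
      using adjoint_pairD(2)[OF assms(2), of a] by (auto simp: tower_of_def)
  qed
qed

text \<open>By adjointness, the set whose supremum defines the structure is
  \<open>{..r (x, y)}\<close>.\<close>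

lemma adjoint_pair_structure_of:
  assumes "adjoint_pair X r \<alpha>"
  shows "structure_of M S X \<alpha> = r"
proof
  fix p
  show "structure_of M S X \<alpha> p = r p"
  proof (cases "p \<in> T X \<times> X")
    case True
    then obtain x y where "p = (x, y)" "x \<in> T X" "y \<in> X" by auto
    moreover from this have "{a. x \<sqsubseteq>[X] \<alpha> a y} = {..r (x, y)}"
      using adjoint_pairD(4)[OF assms] by auto
    ultimately show ?thesis by (simp add: structure_of_def)
  next
    case False
    then show ?thesis
      using PiE_arb[of r "T X \<times> X" "\<lambda>_. UNIV" p] adjoint_pairD(1)[OF assms]
      unfolding structure_of_def matrices_def by simp
  qed
qed

lemma lax_algebra_adjoint_pair:
  fixes r :: "'u \<times> 'u \<Rightarrow> 'v::unital_quantale"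
  assumes X: "X \<in> U" and "is_lax_algebra M S X r"
  shows "adjoint_pair X r (tower_of M S X r)"
proof -
  have r: "r \<in> matrices (T X) X" and unit: "\<And>x. x \<in> X \<Longrightarrow> 1 \<le> r (e X x, x)"
    and mult: "\<And>W y z a. W \<in> T (T X) \<Longrightarrow> y \<in> T X \<Longrightarrow> z \<in> X \<Longrightarrow>
      W \<sqsubseteq>[T X] lift X (T X) (eta_rho X r a) y \<Longrightarrow> a * r (y, z) \<le> r (m X W, z)"
    using assms(2) unfolding is_lax_algebra_iff[OF X] by blast+
  \<comment> \<open>Multiplication axiom at \<open>W = Te\<^sub>X(x)\<close>: \<open>m W = x\<close>, and coherence with \<open>e \<cdot> e \<le> \<eta> \<cdot> \<rho>\<^sup>1\<close>
    together with \<open>x \<le> y\<close> gives \<open>T\<^sub>M r (W, y) \<ge> 1\<close>.\<close>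
  have anti: "r (y, z) \<le> r (x, z)" if "x \<in> T X" "y \<in> T X" "x \<sqsubseteq>[X] y" "z \<in> X" for x y z
  proof -
    let ?W = "Tm X (T X) (e X) x"
    let ?V = "Tm X (T X) (e X) y"
    have "?V \<sqsubseteq>[T X] lift X (T X) (eta_rho X r 1) y"
      \<comment> \<open>This rewrites \<open>?V\<close> as the lift of \<open>e (T X)\<close> after
        \<open>e X\<close>; both sides are then lifts at \<open>y\<close>, and coherence reduces the
        claim to comparing the two maps.\<close>
      unfolding lift_sharp[OF X T_in[OF X] e_hom[OF X] that(2), symmetric]
    proof (rule lift_mono_fun)
      fix x assume "x \<in> X"
      then show "compose X (e (T X)) (e X) x \<sqsubseteq>[T X] eta_rho X r 1 x"
        using X unit by (auto simp: compose_eq eta_rho_apply intro!: Join_upper)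
    qed (use X that in \<open>simp_all add: compose_hom[OF e_hom e_hom] eta_rho_hom\<close>)
    moreover have "?W \<sqsubseteq>[T X] ?V"
      by (rule Tm_mono) (use X that in \<open>simp_all add: e_hom\<close>)
    ultimately have "?W \<sqsubseteq>[T X] lift X (T X) (eta_rho X r 1) y"
      using X that le_trans[of "T X" ?W ?V] by (simp add: e_hom eta_rho_hom)
    from mult[OF _ _ _ this, of z] show ?thesis
      using X that by (simp add: e_hom)
  qed
  \<comment> \<open>Multiplication axiom at \<open>W = \<eta>(\<rho>\<^sup>a(z))\<close> and \<open>y = e\<^sub>X(z)\<close>.\<close>
  have Sup: "a \<le> r (Join X {x \<in> T X. a \<le> r (x, z)}, z)" if "z \<in> X" for a z
  proof -
    let ?A = "{x \<in> T X. a \<le> r (x, z)}"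
    let ?W = "Join (T X) (e (T X) ` ?A)"
    have W: "?W \<in> T (T X)" using X by (auto intro!: Join_in)
    \<comment> \<open>Hence the premise of the multiplication axiom holds by reflexivity.\<close>
    have "?W = lift X (T X) (eta_rho X r a) (e X z)"
      using X that by (simp add: lift_unit eta_rho_hom eta_rho_apply)
    then have 1: "a * r (e X z, z) \<le> r (m X ?W, z)"
      using mult[of ?W "e X z" z a] X that W by simp
    have 2: "a \<le> a * r (e X z, z)"
      using quantale_mult_left_mono[OF unit[OF that], of a] by simp
    have 3: "m X ?W = Join X ?A" by (rule m_Join_e[OF X]) blast
    show ?thesis using order.trans[OF 2 1] unfolding 3 .
  qed
  show ?thesis
    unfolding adjoint_pair_def
  proof (intro conjI allI ballI r)
    fix a :: 'v
    show "tower_of M S X r a \<in> X \<rightarrow>\<^sub>E T X" using X by (auto simp: tower_of_def)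
    fix x y assume x: "x \<in> T X" and y: "y \<in> X"
    let ?A = "{x \<in> T X. a \<le> r (x, y)}"
    have "a \<le> r (x, y) \<longleftrightarrow> x \<sqsubseteq>[X] Join X ?A"
    proof
      assume "x \<sqsubseteq>[X] Join X ?A"
      \<comment> \<open>The join belongs to its own set by \<open>Sup\<close>, and
        \<open>anti\<close> passes membership on to everything below it.\<close>
      then have "r (Join X ?A, y) \<le> r (x, y)"
        using X x y by (intro anti) auto
      with Sup[OF y] show "a \<le> r (x, y)" by (rule order.trans)
    qed (use X x in \<open>auto intro: Join_upper\<close>)
    then show "a \<le> r (x, y) \<longleftrightarrow> x \<sqsubseteq>[X] tower_of M S X r a y"
      using y by (simp add: tower_of_def)
  qed
qed

lemma tower_adjoint_pair:
  fixes \<alpha> :: "'v::unital_quantale \<Rightarrow> 'u \<Rightarrow> 'u"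
  assumes X: "X \<in> U" and "is_tower M S X \<alpha>"
  shows "adjoint_pair X (structure_of M S X \<alpha>) \<alpha>"
proof -
  have hom: "\<alpha> a \<in> X \<rightarrow>\<^sub>E T X" and Inf: "y \<in> X \<Longrightarrow> \<alpha> (Sup A) y = Meet X ((\<lambda>a. \<alpha> a y) ` A)"
    for a A y
    using assms(2) by (auto simp: is_tower_def)
  have in_T [simp]: "\<alpha> a y \<in> T X" if "y \<in> X" for a y
    using hom that by (blast dest: PiE_mem)
  have anti: "\<alpha> b y \<sqsubseteq>[X] \<alpha> a y" if "a \<le> b" "y \<in> X" for a b y
  proof -
    \<comment> \<open>The infimum axiom for the set \<open>{a, b}\<close>, whose supremum is
      \<open>b\<close>.\<close>
    have "\<alpha> b y = Meet X {\<alpha> a y, \<alpha> b y}"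
      using Inf[OF that(2), of "{a, b}"] that by (simp add: sup_absorb2)
    then show ?thesis using X that Meet_lower[of X "{\<alpha> a y, \<alpha> b y}" "\<alpha> a y"] by simp
  qed
  show ?thesis
    unfolding adjoint_pair_def
  proof (intro conjI allI ballI hom)
    show "structure_of M S X \<alpha> \<in> matrices (T X) X"
      by (auto simp: structure_of_def matrices_def)
    fix a x y assume xy: "x \<in> T X" "y \<in> X"
    let ?B = "{b. x \<sqsubseteq>[X] \<alpha> b y}"
    \<comment> \<open>The infimum axiom makes \<open>Sup ?B\<close> a member of \<open>?B\<close>;
      with antitonicity, \<open>?B\<close> consists of all elements below it.\<close>
    have "x \<sqsubseteq>[X] \<alpha> (Sup ?B) y"
      using X xy by (auto simp: Inf intro: Meet_greatest)
    then have "x \<sqsubseteq>[X] \<alpha> a y" if "a \<le> Sup ?B"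
      using X xy anti[OF that] by (auto intro: le_trans)
    then show "a \<le> structure_of M S X \<alpha> (x, y) \<longleftrightarrow> x \<sqsubseteq>[X] \<alpha> a y"
      using xy by (auto simp: structure_of_def intro: Sup_upper)
  qed
qed

text \<open>Adjointness yields the infimum axiom outright and makes the two unit axioms the same
  statement. The multiplication axioms are compared through \<open>m_lift_eta_rho\<close>.\<close>

lemma adjoint_pair_iff:
  fixes r :: "'u \<times> 'u \<Rightarrow> 'v::unital_quantale"
  assumes X: "X \<in> U" and adj: "adjoint_pair X r \<alpha>"
  shows "is_lax_algebra M S X r \<longleftrightarrow> is_tower M S X \<alpha>"
proof -
  note r = adjoint_pairD(1)[OF adj] and hom = adjoint_pairD(2)[OF adj]
    and iff = adjoint_pairD(4)[OF adj] and tower = adjoint_pair_tower_of[OF X adj]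
  note [simp] = adjoint_pairD(3)[OF adj]
  \<comment> \<open>Both sides have the same elements below them: \<open>w\<close> lies below the
    left one iff \<open>Sup A \<le> r (w, y)\<close>, that is, iff \<open>a \<le> r (w, y)\<close>
    for all \<open>a\<close> in \<open>A\<close>.\<close>
  have Inf: "\<alpha> (Sup A) y = Meet X ((\<lambda>a. \<alpha> a y) ` A)" if y: "y \<in> X" for A y
  proof (rule le_eqI[OF X])
    fix w assume w: "w \<in> T X"
    have "w \<sqsubseteq>[X] Meet X ((\<lambda>a. \<alpha> a y) ` A) \<longleftrightarrow> (\<forall>a\<in>A. w \<sqsubseteq>[X] \<alpha> a y)"
    proof
      assume "w \<sqsubseteq>[X] Meet X ((\<lambda>a. \<alpha> a y) ` A)"
      then show "\<forall>a\<in>A. w \<sqsubseteq>[X] \<alpha> a y"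
        using le_trans[OF X _ Meet_lower[OF X]] Meet_in[OF X] w y
        by (auto simp: image_subset_iff)
    qed (use X w y in \<open>auto intro: Meet_greatest\<close>)
    then show "w \<sqsubseteq>[X] \<alpha> (Sup A) y \<longleftrightarrow> w \<sqsubseteq>[X] Meet X ((\<lambda>a. \<alpha> a y) ` A)"
      using w y by (simp add: iff[symmetric] Sup_le_iff)
  qed (use X y in \<open>auto intro!: Meet_in\<close>)
  have unit: "map_le S X X (e X) (\<alpha> 1) \<longleftrightarrow> (\<forall>x\<in>X. 1 \<le> r (e X x, x))"
    using X by (simp add: map_le_def iff)
  have "(\<forall>W\<in>T (T X). \<forall>y\<in>T X. \<forall>z\<in>X. \<forall>a.
       W \<sqsubseteq>[T X] lift X (T X) (eta_rho X r a) y \<longrightarrow> a * r (y, z) \<le> r (m X W, z)) \<longleftrightarrow>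
     (\<forall>a b. map_le S X X (kl_comp M X X X (\<alpha> a) (\<alpha> b)) (\<alpha> (a * b)))" (is "?L \<longleftrightarrow> ?R")
  proof
    assume L: ?L
    show ?R
      unfolding map_le_def
    proof (intro allI ballI)
      fix a b z assume z: "z \<in> X"
      \<comment> \<open>The largest \<open>W\<close> that the lax axiom admits at
        \<open>\<alpha> b z\<close>, a point where adjointness gives
        \<open>b \<le> r (\<alpha> b z, z)\<close>.\<close>
      let ?W = "lift X (T X) (eta_rho X r a) (\<alpha> b z)"
      have W: "?W \<in> T (T X)" using X z by (simp add: eta_rho_hom)
      have "a * b \<le> a * r (\<alpha> b z, z)"
        using X z by (intro quantale_mult_left_mono) (simp add: iff)
      also have "\<dots> \<le> r (m X ?W, z)"
        using L X z W by simp
      also have "m X ?W = lift X X (\<alpha> a) (\<alpha> b z)"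
        using X z by (simp add: m_lift_eta_rho tower)
      finally show "kl_comp M X X X (\<alpha> a) (\<alpha> b) z \<sqsubseteq>[X] \<alpha> (a * b) z"
        using X z hom by (simp add: kl_comp_apply iff)
    qed
  next
    assume R: ?R
    show ?L
    proof (intro ballI allI impI)
      fix W y z a
      \<comment> \<open>The largest index whose tower value at \<open>z\<close> lies above
        \<open>y\<close>.\<close>
      let ?b = "r (y, z)"
      assume W: "W \<in> T (T X)" and y: "y \<in> T X" and z: "z \<in> X"
        and le: "W \<sqsubseteq>[T X] lift X (T X) (eta_rho X r a) y"
      have "m X W \<sqsubseteq>[X] m X (lift X (T X) (eta_rho X r a) y)"
        using X W y le by (auto intro!: m_mono simp: eta_rho_hom)
      then have 1: "m X W \<sqsubseteq>[X] lift X X (\<alpha> a) y"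
        using X y by (simp add: m_lift_eta_rho tower)
      have "y \<sqsubseteq>[X] \<alpha> ?b z" using y z iff by blast
      then have 2: "lift X X (\<alpha> a) y \<sqsubseteq>[X] lift X X (\<alpha> a) (\<alpha> ?b z)"
        using X y z hom by (auto intro: lift_mono)
      have 3: "lift X X (\<alpha> a) (\<alpha> ?b z) \<sqsubseteq>[X] \<alpha> (a * ?b) z"
        using R z by (simp add: map_le_def kl_comp_apply)
      have "m X W \<sqsubseteq>[X] \<alpha> (a * ?b) z"
        by (rule le_trans[OF X 1 le_trans[OF X 2 3]]) (use X W y z hom in simp_all)
      then show "a * ?b \<le> r (m X W, z)" using X W z by (simp add: iff)
    qed
  qed
  then show ?thesis
    unfolding is_lax_algebra_iff[OF X] is_tower_def unit using r hom Inf by blast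
qed

section \<open>Comparison of morphisms\<close>

lemma lax_hom_iff:
  assumes "X \<in> U" "Y \<in> U"
  shows "f \<in> lax_hom M (X, r) (Y, s) \<longleftrightarrow>
    f \<in> X \<rightarrow>\<^sub>E Y \<and> (\<forall>x\<in>T X. \<forall>y\<in>X. r (x, y) \<le> s (Tm X Y f x, f y))"
proof -
  have "mat_comp (T X) Y X (mat_transpose X Y (mat_of_map X Y f))
      (mat_comp (T X) (T Y) Y s (mat_of_map (T X) (T Y) (Tm X Y f))) (x, y) = s (Tm X Y f x, f y)"
    if f: "f \<in> X \<rightarrow>\<^sub>E Y" and "x \<in> T X" "y \<in> X" for x y
    using assms that PiE_mem[OF f \<open>y \<in> X\<close>]
    by (simp add: mat_comp_map_transpose_left mat_comp_map_right)
  then show ?thesis by (auto simp: lax_hom_def Let_def mat_le_def)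
qed

text \<open>The Kleisli composites with \<open>sharp M X Y f\<close> collapse:
  \<open>lift_sharp\<close> handles the left one, \<open>lift_unit\<close> the right one.\<close>

lemma kl_hom_iff:
  assumes XY: "X \<in> U" "Y \<in> U" and "\<And>a. \<alpha> a \<in> X \<rightarrow>\<^sub>E T X" "\<And>a. \<beta> a \<in> Y \<rightarrow>\<^sub>E T Y"
  shows "f \<in> kl_hom M S (X, \<alpha>) (Y, \<beta>) \<longleftrightarrow>
    f \<in> X \<rightarrow>\<^sub>E Y \<and> (\<forall>a. \<forall>x\<in>X. Tm X Y f (\<alpha> a x) \<sqsubseteq>[Y] \<beta> a (f x))"
proof -
  have "kl_comp M X X Y (sharp M X Y f) (\<alpha> a) x = Tm X Y f (\<alpha> a x)"
    "kl_comp M X Y Y (\<beta> a) (sharp M X Y f) x = \<beta> a (f x)"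
    if f: "f \<in> X \<rightarrow>\<^sub>E Y" and x: "x \<in> X" for a x
  proof -
    have "\<alpha> a x \<in> T X" "f x \<in> Y" using assms f x by (auto dest: PiE_mem)
    then show "kl_comp M X X Y (sharp M X Y f) (\<alpha> a) x = Tm X Y f (\<alpha> a x)"
      "kl_comp M X Y Y (\<beta> a) (sharp M X Y f) x = \<beta> a (f x)"
      using assms f x by (simp_all add: kl_comp_apply sharp_def lift_sharp compose_eq lift_unit)
  qed
  then show ?thesis by (auto simp: kl_hom_def map_le_def)
qed

lemma lax_hom_iff_kl_hom:
  fixes r s :: "'u \<times> 'u \<Rightarrow> 'v::unital_quantale"
  assumes XY: "X \<in> U" "Y \<in> U" and r: "adjoint_pair X r \<alpha>" and s: "adjoint_pair Y s \<beta>"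
  shows "lax_hom M (X, r) (Y, s) = kl_hom M S (X, \<alpha>) (Y, \<beta>)"
proof -
  note iffs = adjoint_pairD(4)[OF r] adjoint_pairD(4)[OF s]
  note [simp] = adjoint_pairD(3)[OF r] adjoint_pairD(3)[OF s]
  have equiv: "(\<forall>x\<in>T X. \<forall>y\<in>X. r (x, y) \<le> s (Tm X Y f x, f y)) \<longleftrightarrow>
      (\<forall>a. \<forall>y\<in>X. Tm X Y f (\<alpha> a y) \<sqsubseteq>[Y] \<beta> a (f y))" (is "?L \<longleftrightarrow> ?R")
    if f: "f \<in> X \<rightarrow>\<^sub>E Y" for f
  proof
    assume L: ?L
    show ?R
    proof (intro allI ballI)
      fix a y assume y: "y \<in> X"
      \<comment> \<open>The lax condition is used at \<open>\<alpha> a y\<close>, the largest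
        \<open>x\<close> with \<open>a \<le> r (x, y)\<close>.\<close>
      have "a \<le> r (\<alpha> a y, y)" using XY y by (simp add: iffs)
      also have "\<dots> \<le> s (Tm X Y f (\<alpha> a y), f y)" using L y by simp
      finally show "Tm X Y f (\<alpha> a y) \<sqsubseteq>[Y] \<beta> a (f y)"
        using XY f y PiE_mem[OF f y] by (simp add: iffs)
    qed
  next
    assume R: ?R
    show ?L
    proof (intro ballI)
      fix x y assume x: "x \<in> T X" and y: "y \<in> X"
      \<comment> \<open>Conversely, the tower condition is used at the largest index
        \<open>a\<close> with \<open>x\<close> below \<open>\<alpha> a y\<close>.\<close>
      let ?a = "r (x, y)"
      have fy: "f y \<in> Y" using f y by (rule PiE_mem)
      have "x \<sqsubseteq>[X] \<alpha> ?a y" using x y iffs(1) by blast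
      then have "Tm X Y f x \<sqsubseteq>[Y] Tm X Y f (\<alpha> ?a y)"
        using XY f x y by (auto intro: Tm_mono)
      then have "Tm X Y f x \<sqsubseteq>[Y] \<beta> ?a (f y)"
        by (rule le_trans[OF XY(2)]) (use R XY f x y fy in simp_all)
      then show "?a \<le> s (Tm X Y f x, f y)"
        using XY f x fy by (simp add: iffs)
    qed
  qed
  show ?thesis
    by (rule Set.set_eqI) (simp add: equiv lax_hom_iff[OF XY]
        kl_hom_iff[OF XY adjoint_pairD(2)[OF r] adjoint_pairD(2)[OF s]] cong: conj_cong)
qed

section \<open>The category of lax algebras and the correspondence of objects\<close>

lemma Obj_Alg: "P \<in> Obj (Alg U M S) \<longleftrightarrow> fst P \<in> U \<and> is_lax_algebra M S (fst P) (snd P)"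
  and Obj_KlAlg: "Q \<in> Obj (KlAlg U M S) \<longleftrightarrow> fst Q \<in> U \<and> is_tower M S (fst Q) (snd Q)"
  by (auto simp: Alg_def KlAlg_def split_beta)

text \<open>Closure under composition chains the two pointwise inequalities and uses functoriality
  of \<open>T\<close>. Kleisli algebras are not treated in the same way: their category axioms are
  transported by \<open>concrete_isomorphismI\<close>.\<close>

lemma concrete_category_Alg:
  "concrete_category (Set_cat U)
    (Alg U M S :: ('u set \<times> ('u \<times> 'u \<Rightarrow> 'v::unital_quantale), 'u \<Rightarrow> 'u) category) forget"
    (is "concrete_category _ ?A _")
proof (rule concrete_categoryI)
  have hom: "f \<in> Hom ?A P Q \<longleftrightarrow> f \<in> fst P \<rightarrow>\<^sub>E fst Q \<and>
      (\<forall>x\<in>T (fst P). \<forall>y\<in>fst P. snd P (x, y) \<le> snd Q (Tm (fst P) (fst Q) f x, f y))"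
    if "P \<in> Obj ?A" "Q \<in> Obj ?A" for P Q f
    using that lax_hom_iff[of "fst P" "fst Q" f "snd P" "snd Q"] by (simp add: Obj_Alg, simp add: Alg_def)
  show "fst P \<in> U" if "P \<in> Obj ?A" for P
    using that by (simp add: Obj_Alg)
  show sub: "Hom ?A P Q \<subseteq> fst P \<rightarrow>\<^sub>E fst Q" if "P \<in> Obj ?A" "Q \<in> Obj ?A" for P Q
    using hom[OF that] by blast
  show ident: "Ident ?A P = (\<lambda>x\<in>fst P. x)" for P
    by (simp add: Alg_def split_beta)
  show comp: "Comp ?A P Q R g f = compose (fst P) g f" for P Q R g f
    by (simp add: Alg_def split_beta)
  show "is_category ?A"
  proof (rule is_category_concreteI[OF sub ident comp])
    show "(\<lambda>x\<in>fst P. x) \<in> Hom ?A P P" if "P \<in> Obj ?A" for P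
      using that by (simp add: hom) (simp add: Obj_Alg)
    fix P Q R g f
    assume P: "P \<in> Obj ?A" and Q: "Q \<in> Obj ?A" and R: "R \<in> Obj ?A"
      and f: "f \<in> Hom ?A P Q" and g: "g \<in> Hom ?A Q R"
    have U: "fst P \<in> U" "fst Q \<in> U" "fst R \<in> U" using P Q R by (simp_all add: Obj_Alg)
    have f': "f \<in> fst P \<rightarrow>\<^sub>E fst Q" and g': "g \<in> fst Q \<rightarrow>\<^sub>E fst R"
      using f g P Q R by (auto simp: hom)
    show "compose (fst P) g f \<in> Hom ?A P R"
      unfolding hom[OF P R]
    proof (intro conjI ballI compose_hom[OF f' g'])
      fix x y assume x: "x \<in> T (fst P)" and y: "y \<in> fst P"
      have "snd P (x, y) \<le> snd Q (Tm (fst P) (fst Q) f x, f y)"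
        using f x y by (simp add: hom[OF P Q])
      also have "\<dots> \<le> snd R (Tm (fst Q) (fst R) g (Tm (fst P) (fst Q) f x), g (f y))"
        using g x y U f' PiE_mem[OF f' y] by (simp add: hom[OF Q R])
      finally show "snd P (x, y) \<le>
          snd R (Tm (fst P) (fst R) (compose (fst P) g f) x, compose (fst P) g f y)"
        using U f' g' x y by (simp add: Tm_comp[of _ "fst Q"] compose_eq)
    qed
  qed
qed

text \<open>Comparing hom-sets between images of lax algebras suffices, because by the second claim
  every Kleisli algebra is such an image.\<close>

lemma Alg_KlAlg_correspondence:
  fixes A :: "('u set \<times> ('u \<times> 'u \<Rightarrow> 'v::unital_quantale), 'u \<Rightarrow> 'u) category"
    and K :: "('u set \<times> ('v \<Rightarrow> 'u \<Rightarrow> 'u), 'u \<Rightarrow> 'u) category"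
  defines "A \<equiv> Alg U M S" and "K \<equiv> KlAlg U M S"
  shows "P \<in> Obj A \<Longrightarrow> omap (Alg_to_KlAlg M S) P \<in> Obj K \<and>
      omap (KlAlg_to_Alg M S) (omap (Alg_to_KlAlg M S) P) = P"
    and "Q \<in> Obj K \<Longrightarrow> omap (KlAlg_to_Alg M S) Q \<in> Obj A \<and>
      omap (Alg_to_KlAlg M S) (omap (KlAlg_to_Alg M S) Q) = Q"
    and "P \<in> Obj A \<Longrightarrow> P' \<in> Obj A \<Longrightarrow>
      Hom K (omap (Alg_to_KlAlg M S) P) (omap (Alg_to_KlAlg M S) P') = Hom A P P'"
proof -
  show "omap (Alg_to_KlAlg M S) P \<in> Obj K \<and>
      omap (KlAlg_to_Alg M S) (omap (Alg_to_KlAlg M S) P) = P" if "P \<in> Obj A" for P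
  proof -
    obtain X r where P: "P = (X, r)" by (cases P)
    with that have X: "X \<in> U" and r: "is_lax_algebra M S X r" by (simp_all add: A_def Obj_Alg)
    note adj = lax_algebra_adjoint_pair[OF X r]
    show ?thesis
      using X r adjoint_pair_iff[OF X adj] adjoint_pair_structure_of[OF adj]
      by (simp add: P K_def Obj_KlAlg Alg_to_KlAlg_def KlAlg_to_Alg_def)
  qed
  show "omap (KlAlg_to_Alg M S) Q \<in> Obj A \<and>
      omap (Alg_to_KlAlg M S) (omap (KlAlg_to_Alg M S) Q) = Q" if "Q \<in> Obj K" for Q
  proof -
    obtain X \<alpha> where Q: "Q = (X, \<alpha>)" by (cases Q)
    with that have X: "X \<in> U" and \<alpha>: "is_tower M S X \<alpha>" by (simp_all add: K_def Obj_KlAlg)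
    note adj = tower_adjoint_pair[OF X \<alpha>]
    show ?thesis
      using X \<alpha> adjoint_pair_iff[OF X adj] adjoint_pair_tower_of[OF X adj]
      by (simp add: Q A_def Obj_Alg Alg_to_KlAlg_def KlAlg_to_Alg_def)
  qed
  show "Hom K (omap (Alg_to_KlAlg M S) P) (omap (Alg_to_KlAlg M S) P') = Hom A P P'"
    if "P \<in> Obj A" "P' \<in> Obj A" for P P'
  proof -
    obtain X r X' r' where P: "P = (X, r)" "P' = (X', r')" by (cases P, cases P')
    with that have X: "X \<in> U" "X' \<in> U" and r: "is_lax_algebra M S X r" "is_lax_algebra M S X' r'"
      by (simp_all add: A_def Obj_Alg)
    show ?thesis
      using lax_hom_iff_kl_hom[OF X lax_algebra_adjoint_pair[OF X(1) r(1)]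
          lax_algebra_adjoint_pair[OF X(2) r(2)]]
      by (simp add: P A_def K_def Alg_def KlAlg_def Alg_to_KlAlg_def)
  qed
qed

end

section \<open>Transport along a bijection of objects\<close>

text \<open>The assignments are mutually inverse on objects, the identity on maps, and make
  corresponding hom-sets equal, so \<open>D\<close> inherits the category axioms from
  \<open>C\<close>.\<close>

lemma concrete_isomorphismI:
  fixes C :: "('u set \<times> 's, 'u \<Rightarrow> 'u) category" and D :: "('u set \<times> 't, 'u \<Rightarrow> 'u) category"
  assumes C: "concrete_category (Set_cat U) C forget"
    and Cs: "\<And>P. Ident C P = (\<lambda>x\<in>fst P. x)" "\<And>P Q R g f. Comp C P Q R g f = compose (fst P) g f"
    and Ds: "\<And>P. Ident D P = (\<lambda>x\<in>fst P. x)" "\<And>P Q R g f. Comp D P Q R g f = compose (fst P) g f"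
    and F: "\<And>P. fst (omap F P) = fst P" "\<And>P Q f. amap F P Q f = f"
    and G: "\<And>Q. fst (omap G Q) = fst Q" "\<And>P Q f. amap G P Q f = f"
    and FP: "\<And>P. P \<in> Obj C \<Longrightarrow> omap F P \<in> Obj D \<and> omap G (omap F P) = P"
    and GQ: "\<And>Q. Q \<in> Obj D \<Longrightarrow> omap G Q \<in> Obj C \<and> omap F (omap G Q) = Q"
    and hom: "\<And>P P'. P \<in> Obj C \<Longrightarrow> P' \<in> Obj C \<Longrightarrow> Hom D (omap F P) (omap F P') = Hom C P P'"
  shows "concrete_category (Set_cat U) D forget \<and> concretely_isomorphic C forget D forget \<and>
    concrete_functor C forget D forget F \<and> concrete_functor D forget C forget G \<and>
    inverse_functors C D F G"
proof -
  have cat: "is_category C" and obj: "\<And>P. P \<in> Obj C \<Longrightarrow> fst P \<in> U"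
    and sub: "\<And>P Q. P \<in> Obj C \<Longrightarrow> Q \<in> Obj C \<Longrightarrow> Hom C P Q \<subseteq> fst P \<rightarrow>\<^sub>E fst Q"
    using C by (simp_all add: concrete_category_def is_functor_def forget_def Set_cat_def subset_iff)
  \<comment> \<open>Each object of \<open>D\<close> equals \<open>omap F (omap G Q)\<close>, which
    brings its hom-sets within reach of \<open>hom\<close>.\<close>
  have hom': "Hom D Q Q' = Hom C (omap G Q) (omap G Q')" if "Q \<in> Obj D" "Q' \<in> Obj D" for Q Q'
    using hom[of "omap G Q" "omap G Q'"] GQ that by simp
  have subD: "Hom D Q Q' \<subseteq> fst Q \<rightarrow>\<^sub>E fst Q'" if "Q \<in> Obj D" "Q' \<in> Obj D" for Q Q'
    using hom'[OF that] sub[of "omap G Q" "omap G Q'"] GQ that by (simp add: G)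
  have "is_category D"
  proof (rule is_category_concreteI[OF subD Ds])
    show "(\<lambda>x\<in>fst P. x) \<in> Hom D P P" if "P \<in> Obj D" for P
      using cat GQ[OF that] that unfolding is_category_def by (metis Cs(1) G(1) hom')
    show "compose (fst P) g f \<in> Hom D P R"
      if "P \<in> Obj D" "Q \<in> Obj D" "R \<in> Obj D" "f \<in> Hom D P Q" "g \<in> Hom D Q R" for P Q R g f
    proof -
      \<comment> \<open>The composite is formed in \<open>C\<close> and read back in
        \<open>D\<close> through \<open>hom'\<close>.\<close>
      have "Comp C (omap G P) (omap G Q) (omap G R) g f \<in> Hom C (omap G P) (omap G R)"
        using cat GQ that unfolding is_category_def by (simp add: hom')
      then show ?thesis using that by (simp add: Cs G hom')
    qed
  qed
  then have D: "concrete_category (Set_cat U) D forget"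
    by (rule concrete_categoryI) (use GQ obj G subD Ds in metis)+
  have "concrete_functor C forget D forget F"
    unfolding concrete_functor_def is_functor_def functor_eq_def functor_comp_def forget_def
    using FP hom by (simp add: Cs Ds F)
  moreover have "concrete_functor D forget C forget G"
    unfolding concrete_functor_def is_functor_def functor_eq_def functor_comp_def forget_def
    using GQ hom' by (simp add: Cs Ds G)
  moreover have "inverse_functors C D F G"
    using FP GQ by (simp add: inverse_functors_def functor_eq_def functor_comp_def functor_id_def F G)
  ultimately show ?thesis
    using D unfolding concretely_isomorphic_def by blast
qed

theorem theorem4p3:
  fixes U :: "'u set set"
    and M :: "'u set_monad"
    and S :: "'u sup_functor"
    and A :: "('u set \<times> ('u \<times> 'u \<Rightarrow> 'v::unital_quantale), 'u \<Rightarrow> 'u) category"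
    and K :: "('u set \<times> ('v \<Rightarrow> 'u \<Rightarrow> 'u), 'u \<Rightarrow> 'u) category"
  defines "A \<equiv> Alg U M S"
    and "K \<equiv> KlAlg U M S"
  assumes "is_monad (Set_cat U) M"
    and "factors_coherently_through_Sup U M S"
    and "completely_distributive TYPE('v)"
    and "(bot :: 'v) \<noteq> 1"
  shows "concrete_category (Set_cat U) A forget \<and>
         concrete_category (Set_cat U) K forget \<and>
         concretely_isomorphic A forget K forget \<and>
         concrete_functor A forget K forget (Alg_to_KlAlg M S) \<and>
         concrete_functor K forget A forget (KlAlg_to_Alg M S) \<and>
         inverse_functors A K (Alg_to_KlAlg M S) (KlAlg_to_Alg M S)"
proof -
  interpret coherent_monad U M S
    by unfold_locales (fact assms)+
  have A: "concrete_category (Set_cat U) A forget"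
    unfolding A_def by (rule concrete_category_Alg)
  moreover have "concrete_category (Set_cat U) K forget \<and>
      concretely_isomorphic A forget K forget \<and>
      concrete_functor A forget K forget (Alg_to_KlAlg M S) \<and>
      concrete_functor K forget A forget (KlAlg_to_Alg M S) \<and>
      inverse_functors A K (Alg_to_KlAlg M S) (KlAlg_to_Alg M S)"
  proof (rule concrete_isomorphismI[OF A])
    fix P assume "P \<in> Obj A"
    then show "omap (Alg_to_KlAlg M S) P \<in> Obj K \<and>
        omap (KlAlg_to_Alg M S) (omap (Alg_to_KlAlg M S) P) = P"
      unfolding A_def K_def by (rule Alg_KlAlg_correspondence(1))
  next
    fix Q assume "Q \<in> Obj K"
    then show "omap (KlAlg_to_Alg M S) Q \<in> Obj A \<and>
        omap (Alg_to_KlAlg M S) (omap (KlAlg_to_Alg M S) Q) = Q"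
      unfolding A_def K_def by (rule Alg_KlAlg_correspondence(2))
  next
    fix P P' assume "P \<in> Obj A" "P' \<in> Obj A"
    then show "Hom K (omap (Alg_to_KlAlg M S) P) (omap (Alg_to_KlAlg M S) P') = Hom A P P'"
      unfolding A_def K_def by (rule Alg_KlAlg_correspondence(3))
  qed (simp_all add: A_def K_def Alg_def KlAlg_def Alg_to_KlAlg_def KlAlg_to_Alg_def split_beta)
  ultimately show ?thesis by simp
qed

end
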